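(* Let $k\ge2$, let $\alpha_1,\dots,\alpha_{k-1}$ be real numbers, let $F$ be the distribution function of an absolutely continuous probability measure $\nu$ on $\mathbb R$, and let \[ K(x_1,\dots,x_k)=\sum_{\Delta=1}^{k-1}\sum_{j=1}^{k-\Delta}\alpha_\Delta\operatorname{sgn}(x_{\Delta+j}-x_j). \] Then the $\mathcal L_1$ component of $K$ is \[ K_1(x_1,\dots,x_k)=\alpha_{k-1}\bigl(\operatorname{sgn}(x_k-x_1)-2(F(x_k)-F(x_1))\bigr). \]
   Context: Let $\pi_k=\nu^{\otimes k}$ and let $\mathcal H_k$ be the Hilbert space of functions in $L^2(\mathbb R^k,\pi_k)$ with zero $\pi_k$-integral (it contains $K$). Define $P$ on $\mathcal H_k$ by $Pf(x_1,\dots,x_k)=\int f(x_2,\dots,x_k,\xi)\,\nu(d\xi)$, let $P^*$ be its adjoint, and $B_k=I+P+P^*+\cdots+P^{k-1}+(P^* )^{k-1}$ (self-adjoint). $\mathcal L_1$ is the eigenspace of $B_k$ for eigenvalue $1$; equivalently, $\mathcal L_1$ is the set of $f\in\mathcal H_k$ with $\int f\,\nu(dx_1)=0$ and $\int f\,\nu(dx_k)=0$. The $\mathcal L_1$ component of $f\in\mathcal H_k$ is its orthogonal projection onto $\mathcal L_1$ (equality is $\pi_k$-a.e.). *)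

theory Defs
  imports "HOL-Probability.Probability"
begin

(* Points (x_1,...,x_k) are extensional functions on {1..k}. Elements of L^2 are represented by
   actual functions; the Hilbert-space notions below respect almost-everywhere equality. *)

abbreviation prod_measure :: "nat \<Rightarrow> real measure \<Rightarrow> (nat \<Rightarrow> real) measure" where
  "prod_measure k \<nu> \<equiv> PiM {1..k} (\<lambda>_. \<nu>)"

definition hilb :: "nat \<Rightarrow> real measure \<Rightarrow> ((nat \<Rightarrow> real) \<Rightarrow> real) set" where
  "hilb k \<nu> = {f. f \<in> borel_measurable (prod_measure k \<nu>) \<and>
                  integrable (prod_measure k \<nu>) (\<lambda>x. (f x)\<^sup>2) \<and>
                  (\<integral>x. f x \<partial>prod_measure k \<nu>) = 0}"

definition hinner ::
  "nat \<Rightarrow> real measure \<Rightarrow> ((nat \<Rightarrow> real) \<Rightarrow> real) \<Rightarrow> ((nat \<Rightarrow> real) \<Rightarrow> real) \<Rightarrow> real" where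
  "hinner k \<nu> f g = (\<integral>x. f x * g x \<partial>prod_measure k \<nu>)"

definition P_op ::
  "nat \<Rightarrow> real measure \<Rightarrow> ((nat \<Rightarrow> real) \<Rightarrow> real) \<Rightarrow> (nat \<Rightarrow> real) \<Rightarrow> real" where
  "P_op k \<nu> f = (\<lambda>x. \<integral>\<xi>. f (\<lambda>i\<in>{1..k}. if i < k then x (i + 1) else \<xi>) \<partial>\<nu>)"

(* Same scheme as the library's adjoint, relative to hilb. The element chosen is determined up
   to almost-everywhere equality and depends only on the almost-everywhere class of f. *)
definition hadjoint ::
  "nat \<Rightarrow> real measure \<Rightarrow> (((nat \<Rightarrow> real) \<Rightarrow> real) \<Rightarrow> (nat \<Rightarrow> real) \<Rightarrow> real) \<Rightarrow>
   ((nat \<Rightarrow> real) \<Rightarrow> real) \<Rightarrow> (nat \<Rightarrow> real) \<Rightarrow> real" where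
  "hadjoint k \<nu> T f =
     (SOME g. g \<in> hilb k \<nu> \<and> (\<forall>h\<in>hilb k \<nu>. hinner k \<nu> (T h) f = hinner k \<nu> h g))"

definition B_op ::
  "nat \<Rightarrow> real measure \<Rightarrow> ((nat \<Rightarrow> real) \<Rightarrow> real) \<Rightarrow> (nat \<Rightarrow> real) \<Rightarrow> real" where
  "B_op k \<nu> f = (\<lambda>x. f x +
     (\<Sum>i = 1..k - 1. (P_op k \<nu> ^^ i) f x + (hadjoint k \<nu> (P_op k \<nu>) ^^ i) f x))"

definition B_eigenspace :: "nat \<Rightarrow> real measure \<Rightarrow> real \<Rightarrow> ((nat \<Rightarrow> real) \<Rightarrow> real) set" where
  "B_eigenspace k \<nu> c =
     {f \<in> hilb k \<nu>. AE x in prod_measure k \<nu>. B_op k \<nu> f x = c * f x}"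

(* g is (a representative of) the orthogonal projection of f onto the subspace V of hilb. *)
definition is_orth_proj ::
  "nat \<Rightarrow> real measure \<Rightarrow> ((nat \<Rightarrow> real) \<Rightarrow> real) set \<Rightarrow>
   ((nat \<Rightarrow> real) \<Rightarrow> real) \<Rightarrow> ((nat \<Rightarrow> real) \<Rightarrow> real) \<Rightarrow> bool" where
  "is_orth_proj k \<nu> V f g \<longleftrightarrow>
     f \<in> hilb k \<nu> \<and> g \<in> V \<and> (\<forall>h\<in>V. hinner k \<nu> (\<lambda>x. f x - g x) h = 0)"

end

(* P^i and its adjoint A^i average out i coordinates and shift the others, so P^k = A^k = 0 on
   functions of mean zero, and PA averages out the first coordinate. If B h = h, i.e.
   S = (sum over 0 < i < k of P^i h + A^i h) vanishes, then comparing PS = 0 with PAS = 0 telescopes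
   to P h = P A h. Iterating, P^i h = P^i A^i h, so <P^i h, h> = |A^i h|^2; now <S, h> = 0 forces
   A h = 0 and then P h = P A h = 0. Conversely P h = A h = 0 gives B h = h.

   Every term of K - K1 is free of x_1 (and then equals P A g) or free of x_k (and then equals
   A P g), hence is orthogonal to such h, while P K1 = A K1 = 0 because sgn(xi - c) has mean
   1 - 2 F(c) and F has mean 1/2. *)
theory Submission
  imports Defs
begin

text \<open>The iteration rests on an exchange rule: with E_j averaging out coordinate j, P^i E_1 =
  E_(i+1) P^i almost everywhere for i < k, by Fubini and a renaming of positions. With P A = E_1 it
  gives P^(i+1) h = P^i E_1 h = E_(i+1) P^i h = E_(i+1) P^i A^i h = P^i E_1 A^i h = P^(i+1) A^(i+1)
  h. Positivity depends on this, since <P^i h, h> has no definite sign for general h.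

  Origin of K1: sgn(x_k - x_1) is the only sign that involves both extreme coordinates, and K1 is
  \<alpha>_(k-1) times (I - E_1)(I - E_k) applied to it. Indeed E_1 turns this sign into 2 F(x_k) -
  1, E_k turns it into 1 - 2 F(x_1), and E_1 E_k turns it into 0.

  Null sets shape the argument: the adjoint is determined only up to almost-everywhere equality, so
  the eigenvalue equation is an almost-everywhere statement, and averaging it again requires
  operators that respect null sets.\<close>

lemma integrable_mult_of_squares:
  fixes f g :: "'a \<Rightarrow> real"
  assumes "f \<in> borel_measurable M" "g \<in> borel_measurable M"
    and "integrable M (\<lambda>x. (f x)\<^sup>2)" "integrable M (\<lambda>x. (g x)\<^sup>2)"
  shows "integrable M (\<lambda>x. f x * g x)"
proof (rule Bochner_Integration.integrable_bound)
  show "integrable M (\<lambda>x. (f x)\<^sup>2 + (g x)\<^sup>2)" using assms by simp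
  show "(\<lambda>x. f x * g x) \<in> borel_measurable M" using assms by simp
  have "\<bar>a * b\<bar> \<le> a\<^sup>2 + b\<^sup>2" for a b :: real
    using sum_squares_bound[of "\<bar>a\<bar>" "\<bar>b\<bar>"] mult_nonneg_nonneg[OF abs_ge_zero[of a] abs_ge_zero[of b]]
    unfolding abs_mult power2_abs mult.assoc by linarith
  then show "AE x in M. norm (f x * g x) \<le> norm ((f x)\<^sup>2 + (g x)\<^sup>2)" by simp
qed

section \<open>Averaging operators as resampling of independent coordinates\<close>

locale iid_coordinates = real_distribution \<nu> for \<nu> :: "real measure" +
  fixes k :: nat
  assumes k_ge_2: "2 \<le> k"
begin

declare One_nat_def [simp del]

abbreviation "\<pi> \<equiv> prod_measure k \<nu>"

text \<open>A position sent to 0 receives the fresh variable \<open>\<xi>\<close>; all averaging operators below are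
  \<open>avg s\<close> for an injective \<open>s\<close>, which makes \<open>resample s\<close> measure preserving.\<close>

definition resample :: "(nat \<Rightarrow> nat) \<Rightarrow> (nat \<Rightarrow> real) \<Rightarrow> real \<Rightarrow> nat \<Rightarrow> real" where
  "resample s x \<xi> = (\<lambda>i\<in>{1..k}. if s i = 0 then \<xi> else x (s i))"

definition avg :: "(nat \<Rightarrow> nat) \<Rightarrow> ((nat \<Rightarrow> real) \<Rightarrow> real) \<Rightarrow> (nat \<Rightarrow> real) \<Rightarrow> real" where
  "avg s f x = (\<integral>\<xi>. f (resample s x \<xi>) \<partial>\<nu>)"

definition admissible :: "(nat \<Rightarrow> nat) \<Rightarrow> bool" where
  "admissible s \<longleftrightarrow> inj_on s {1..k} \<and> s ` {1..k} \<subseteq> {0..k}"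

definition L2 :: "((nat \<Rightarrow> real) \<Rightarrow> real) set" where
  "L2 = {f \<in> borel_measurable \<pi>. integrable \<pi> (\<lambda>x. (f x)\<^sup>2)}"

lemma space_nu [simp]: "space \<nu> = UNIV"
  using events_eq_borel sets_eq_imp_space_eq by force

lemma space_pi: "space \<pi> = extensional {1..k}"
  by (simp add: space_PiM PiE_def)

lemma prob_pi: "prob_space \<pi>"
  by (intro prob_space_PiM prob_space_axioms)

lemma pair_pi_nu: "pair_sigma_finite \<pi> \<nu>"
  unfolding pair_sigma_finite_def
  by (intro conjI prob_space_imp_sigma_finite prob_pi prob_space_axioms)

text \<open>Points live on \<open>{1..k}\<close>, so index 0 is free to store an independent draw,
  and the result is k + 1 iid coordinates. \<open>distr_pair_PiM_eq_PiM\<close> takes the new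
  coordinate as the first factor, hence the swap.\<close>

lemma distr_extend:
  "distr (\<pi> \<Otimes>\<^sub>M \<nu>) (PiM {0..k} (\<lambda>_. \<nu>)) (\<lambda>(x, \<xi>). x(0 := \<xi>)) = PiM {0..k} (\<lambda>_. \<nu>)"
proof -
  interpret Q: pair_sigma_finite \<nu> \<pi>
    using pair_pi_nu by (simp add: pair_sigma_finite_def)
  have ins: "insert 0 {1..k} = {0..k}" by auto
  have m: "(\<lambda>(\<xi>, x). x(0 := \<xi>)) \<in> measurable (\<nu> \<Otimes>\<^sub>M \<pi>) (PiM {0..k} (\<lambda>_. \<nu>))"
    unfolding case_prod_unfold by (rule measurable_fun_upd[where J="{1..k}"]) auto
  have m2: "(\<lambda>(x, \<xi>). (\<xi>, x)) \<in> measurable (\<pi> \<Otimes>\<^sub>M \<nu>) (\<nu> \<Otimes>\<^sub>M \<pi>)"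
    by (rule measurable_pair_swap')
  have "PiM {0..k} (\<lambda>_. \<nu>) =
      distr (\<nu> \<Otimes>\<^sub>M \<pi>) (PiM {0..k} (\<lambda>_. \<nu>)) (\<lambda>(\<xi>, x). x(0 := \<xi>))"
    using distr_pair_PiM_eq_PiM[of "{1..k}" "\<lambda>_. \<nu>" 0] prob_space_axioms by (simp add: ins)
  also have "\<nu> \<Otimes>\<^sub>M \<pi> = distr (\<pi> \<Otimes>\<^sub>M \<nu>) (\<nu> \<Otimes>\<^sub>M \<pi>) (\<lambda>(x, \<xi>). (\<xi>, x))"
    by (rule Q.distr_pair_swap)
  finally have *: "PiM {0..k} (\<lambda>_. \<nu>) = distr (\<pi> \<Otimes>\<^sub>M \<nu>) (PiM {0..k} (\<lambda>_. \<nu>))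
      ((\<lambda>(\<xi>, x). x(0 := \<xi>)) \<circ> (\<lambda>(x, \<xi>). (\<xi>, x)))"
    unfolding distr_distr[OF m m2] .
  have "(\<lambda>(\<xi>, x). x(0 := \<xi>)) \<circ> (\<lambda>(x, \<xi>). (\<xi>, x)) = (\<lambda>(x, \<xi> :: real). x(0 := \<xi>))"
    by (rule ext) (simp only: comp_apply case_prod_unfold fst_conv snd_conv)
  from *[unfolded this] show ?thesis by (rule sym)
qed

lemma measurable_extend [measurable]:
  "(\<lambda>(x, \<xi>). x(0 := \<xi>)) \<in> measurable (\<pi> \<Otimes>\<^sub>M \<nu>) (PiM {0..k} (\<lambda>_. \<nu>))"
  unfolding case_prod_unfold by (rule measurable_fun_upd[where J="{1..k}"]) auto

lemma measurable_reindex: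
  "s ` I \<subseteq> J \<Longrightarrow> (\<lambda>y. \<lambda>i\<in>I. y (s i)) \<in> measurable (PiM J (\<lambda>_. \<nu>)) (PiM I (\<lambda>_. \<nu>))"
  by (intro measurable_restrict measurable_component_singleton) auto

lemma distr_reindex:
  assumes "inj_on s I" "s ` I \<subseteq> J"
  shows "distr (PiM J (\<lambda>_. \<nu>)) (PiM I (\<lambda>_. \<nu>)) (\<lambda>y. \<lambda>i\<in>I. y (s i)) = PiM I (\<lambda>_. \<nu>)"
  using distr_PiM_reindex[of J "\<lambda>_. \<nu>" s I] assms prob_space_axioms by auto

lemma resample_eq_reindex: "resample s x \<xi> = (\<lambda>i\<in>{1..k}. (x(0 := \<xi>)) (s i))"
  by (auto simp: resample_def restrict_def)

lemma measurable_resample_pair: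
  assumes "admissible s"
  shows "(\<lambda>(x, \<xi>). resample s x \<xi>) \<in> measurable (\<pi> \<Otimes>\<^sub>M \<nu>) \<pi>"
proof -
  have "s ` {1..k} \<subseteq> {0..k}" using assms by (simp add: admissible_def)
  from measurable_comp[OF measurable_extend measurable_reindex[OF this]]
  show ?thesis by (simp add: resample_eq_reindex comp_def case_prod_unfold)
qed

text \<open>Resampling stores \<xi> at index 0 and then reads k of the k + 1 iid variables along
  \<open>s\<close>. Reads at distinct indices are again iid, which is where injectivity
  enters.\<close>

lemma distr_resample:
  assumes "admissible s"
  shows "distr (\<pi> \<Otimes>\<^sub>M \<nu>) \<pi> (\<lambda>(x, \<xi>). resample s x \<xi>) = \<pi>"
proof -
  have s: "inj_on s {1..k}" "s ` {1..k} \<subseteq> {0..k}" using assms by (auto simp: admissible_def)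
  have "\<pi> = distr (distr (\<pi> \<Otimes>\<^sub>M \<nu>) (PiM {0..k} (\<lambda>_. \<nu>)) (\<lambda>(x, \<xi>). x(0 := \<xi>))) \<pi>
      (\<lambda>y. \<lambda>i\<in>{1..k}. y (s i))"
    by (simp add: distr_extend distr_reindex[OF s])
  also have "\<dots> = distr (\<pi> \<Otimes>\<^sub>M \<nu>) \<pi> (\<lambda>(x, \<xi>). resample s x \<xi>)"
    unfolding distr_distr[OF measurable_reindex[OF s(2)] measurable_extend]
    by (rule arg_cong[where f="distr _ _"]) (rule ext, simp only: comp_apply case_prod_unfold resample_eq_reindex)
  finally show ?thesis by (rule sym)
qed

lemma resample_in_space [simp]: "resample s x \<xi> \<in> space \<pi>"
  by (simp add: space_pi resample_def)

lemma measurable_resample: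
  assumes "admissible s" "x \<in> space \<pi>"
  shows "resample s x \<in> measurable \<nu> \<pi>"
  using measurable_Pair2[OF measurable_resample_pair[OF assms(1)] assms(2)] by simp

lemma measurable_compose_resample:
  assumes "admissible s" "f \<in> borel_measurable \<pi>"
  shows "(\<lambda>(x, \<xi>). f (resample s x \<xi>)) \<in> borel_measurable (\<pi> \<Otimes>\<^sub>M \<nu>)"
  using measurable_compose[OF measurable_resample_pair[OF assms(1)] assms(2)]
  by (simp add: case_prod_unfold)

lemma borel_measurable_avg:
  assumes "admissible s" "f \<in> borel_measurable \<pi>"
  shows "avg s f \<in> borel_measurable \<pi>"
  unfolding avg_def
  by (rule borel_measurable_lebesgue_integral) (use measurable_compose_resample[OF assms] in simp)

text \<open>Measure preservation pulls a null set back to a null set of the product, and Fubini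
  makes almost every section null. This lets almost-everywhere identities pass under the averaging
  integral.\<close>

lemma AE_resample:
  assumes "admissible s" "AE x in \<pi>. Q x"
  shows "AE x in \<pi>. AE \<xi> in \<nu>. Q (resample s x \<xi>)"
proof -
  interpret pair_sigma_finite \<pi> \<nu> by (rule pair_pi_nu)
  have "AE p in \<pi> \<Otimes>\<^sub>M \<nu>. Q ((\<lambda>(x, \<xi>). resample s x \<xi>) p)"
    using AE_distrD[OF measurable_resample_pair[OF assms(1)], of Q] assms(2)
    unfolding distr_resample[OF assms(1)] by blast
  from AE_pair[OF this] show ?thesis by simp
qed

lemma avg_cong_AE:
  assumes s: "admissible s" and [measurable]: "f \<in> borel_measurable \<pi>" "g \<in> borel_measurable \<pi>"
    and eq: "AE x in \<pi>. f x = g x"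
  shows "AE x in \<pi>. avg s f x = avg s g x"
  using AE_resample[OF s eq] AE_space
proof eventually_elim
  case (elim x)
  note [measurable] = measurable_resample[OF s elim(2)]
  show ?case unfolding avg_def by (rule integral_cong_AE) (use elim in auto)
qed

lemma integrable_resample:
  fixes f :: "(nat \<Rightarrow> real) \<Rightarrow> real"
  assumes "admissible s" "integrable \<pi> f"
  shows "integrable (\<pi> \<Otimes>\<^sub>M \<nu>) (\<lambda>(x, \<xi>). f (resample s x \<xi>))"
  using integrable_distr[OF measurable_resample_pair[OF assms(1)], of f] assms(2)
  unfolding distr_resample[OF assms(1)] by (simp add: case_prod_unfold)

text \<open>Fubini for \<open>f\<close> composed with the resampling map, whose law is again
  \<open>\<pi>\<close>.\<close>

lemma integrable_avg:
  assumes "admissible s" "integrable \<pi> f"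
  shows "AE x in \<pi>. integrable \<nu> (\<lambda>\<xi>. f (resample s x \<xi>))" "integrable \<pi> (avg s f)"
    "(\<integral>x. avg s f x \<partial>\<pi>) = (\<integral>x. f x \<partial>\<pi>)"
proof -
  interpret pair_sigma_finite \<pi> \<nu> by (rule pair_pi_nu)
  note i = integrable_resample[OF assms]
  show "AE x in \<pi>. integrable \<nu> (\<lambda>\<xi>. f (resample s x \<xi>))" using AE_integrable_fst'[OF i] by simp
  show "integrable \<pi> (avg s f)" using integrable_fst'[OF i] by (simp add: avg_def[abs_def])
  have "(\<integral>x. avg s f x \<partial>\<pi>) = (\<integral>p. f ((\<lambda>(x, \<xi>). resample s x \<xi>) p) \<partial>(\<pi> \<Otimes>\<^sub>M \<nu>))"
    using integral_fst'[OF i] by (simp add: avg_def case_prod_unfold)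
  also have "\<dots> = (\<integral>x. f x \<partial>\<pi>)"
    using integral_distr[OF measurable_resample_pair[OF assms(1)], of f] assms(2)
    unfolding distr_resample[OF assms(1)] by simp
  finally show "(\<integral>x. avg s f x \<partial>\<pi>) = (\<integral>x. f x \<partial>\<pi>)" .
qed

section \<open>Square-integrable functions under averaging\<close>

lemma L2_integrable: "f \<in> L2 \<Longrightarrow> integrable \<pi> f"
proof -
  interpret Pi: prob_space \<pi> by (rule prob_pi)
  show "f \<in> L2 \<Longrightarrow> integrable \<pi> f"
    by (auto simp: L2_def intro: Pi.square_integrable_imp_integrable)
qed

lemma L2_borel: "f \<in> L2 \<Longrightarrow> f \<in> borel_measurable \<pi>"
  by (simp add: L2_def)

lemma L2_mult:
  assumes "f \<in> L2" "g \<in> L2"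
  shows "integrable \<pi> (\<lambda>x. f x * g x)"
  by (rule integrable_mult_of_squares) (use assms in \<open>auto simp: L2_def\<close>)

lemma L2_add: "f \<in> L2 \<Longrightarrow> g \<in> L2 \<Longrightarrow> (\<lambda>x. f x + g x) \<in> L2"
  using L2_mult[of f g] by (auto simp: L2_def power2_sum mult.assoc)

lemma L2_cmult: "f \<in> L2 \<Longrightarrow> (\<lambda>x. c * f x) \<in> L2"
  by (auto simp: L2_def power_mult_distrib)

lemma L2_zero: "(\<lambda>x. 0) \<in> L2"
  by (simp add: L2_def)

lemma L2_diff: "f \<in> L2 \<Longrightarrow> g \<in> L2 \<Longrightarrow> (\<lambda>x. f x - g x) \<in> L2"
  using L2_add[of f "\<lambda>x. -1 * g x"] L2_cmult[of g "-1"] by simp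

lemma L2_sum: "(\<And>i. i \<in> I \<Longrightarrow> f i \<in> L2) \<Longrightarrow> (\<lambda>x. \<Sum>i\<in>I. f i x) \<in> L2"
  by (induction I rule: infinite_finite_induct) (auto simp: L2_zero intro!: L2_add)

lemma L2_bounded:
  assumes "f \<in> borel_measurable \<pi>" "\<And>x. \<bar>f x\<bar> \<le> c"
  shows "f \<in> L2"
proof -
  interpret Pi: prob_space \<pi> by (rule prob_pi)
  have "integrable \<pi> (\<lambda>x. (f x)\<^sup>2)"
  proof (rule Pi.integrable_const_bound[where B="c\<^sup>2"])
    show "AE x in \<pi>. norm ((f x)\<^sup>2) \<le> c\<^sup>2"
      using power_mono[OF assms(2) abs_ge_zero, of _ 2] by simp
  qed (use assms in simp)
  with assms show ?thesis by (simp add: L2_def)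
qed

text \<open>Jensen's inequality for the square: almost every section is square integrable, and
  nonnegativity of its variance bounds the squared mean by the mean of the square.\<close>

lemma avg_L2:
  assumes s: "admissible s" and f: "f \<in> L2"
  shows "avg s f \<in> L2"
proof -
  have f2: "integrable \<pi> (\<lambda>x. (f x)\<^sup>2)" and [measurable]: "f \<in> borel_measurable \<pi>"
    using f by (auto simp: L2_def)
  note [measurable] = borel_measurable_avg[OF s]
  have "integrable \<pi> (\<lambda>x. (avg s f x)\<^sup>2)"
  proof (rule Bochner_Integration.integrable_bound[OF integrable_avg(2)[OF s f2]])
    show "(\<lambda>x. (avg s f x)\<^sup>2) \<in> borel_measurable \<pi>" by measurable
    show "AE x in \<pi>. norm ((avg s f x)\<^sup>2) \<le> norm (avg s (\<lambda>x. (f x)\<^sup>2) x)"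
      using integrable_avg(1)[OF s f2] AE_space
    proof eventually_elim
      case (elim x)
      note [measurable] = measurable_resample[OF s elim(2)]
      have i: "integrable \<nu> (\<lambda>\<xi>. f (resample s x \<xi>))"
        by (rule square_integrable_imp_integrable) (use elim in auto)
      have "0 \<le> variance (\<lambda>\<xi>. f (resample s x \<xi>))" by (rule variance_positive)
      then show ?case using variance_eq[OF i elim(1)] by (simp add: avg_def)
    qed
  qed
  then show ?thesis by (simp add: L2_def)
qed

text \<open>Only almost everywhere: where a section is not integrable its integral defaults to 0,
  and additivity may break down.\<close>

lemma avg_add_AE:
  assumes "admissible s" "f \<in> L2" "g \<in> L2"
  shows "AE x in \<pi>. avg s (\<lambda>x. f x + g x) x = avg s f x + avg s g x"
  using integrable_avg(1)[OF assms(1) L2_integrable[OF assms(2)]]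
    integrable_avg(1)[OF assms(1) L2_integrable[OF assms(3)]]
  by eventually_elim (simp add: avg_def)

lemma avg_sum_AE:
  assumes s: "admissible s" and "\<And>i. i \<in> I \<Longrightarrow> f i \<in> L2" "finite I"
  shows "AE x in \<pi>. avg s (\<lambda>x. \<Sum>i\<in>I. f i x) x = (\<Sum>i\<in>I. avg s (f i) x)"
proof -
  have "AE x in \<pi>. \<forall>i\<in>I. integrable \<nu> (\<lambda>\<xi>. f i (resample s x \<xi>))"
    by (rule AE_finite_allI) (use assms integrable_avg(1)[OF s] L2_integrable in auto)
  then show ?thesis by eventually_elim (simp add: avg_def)
qed

section \<open>Almost-everywhere equality and iterated averages\<close>

abbreviation aeq :: "((nat \<Rightarrow> real) \<Rightarrow> real) \<Rightarrow> ((nat \<Rightarrow> real) \<Rightarrow> real) \<Rightarrow> bool" (infix "\<simeq>" 50)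
  where "f \<simeq> g \<equiv> AE x in \<pi>. f x = g x"

lemma aeq_trans [trans]: "f \<simeq> g \<Longrightarrow> g \<simeq> h \<Longrightarrow> f \<simeq> h"
  by (drule (1) eventually_conj, erule eventually_mono) simp

lemma avg_iter_L2: "admissible s \<Longrightarrow> f \<in> L2 \<Longrightarrow> (avg s ^^ i) f \<in> L2"
  by (induction i) (auto intro: avg_L2)

lemma avg_iter_cong:
  assumes "admissible s" "f \<in> L2" "g \<in> L2" "f \<simeq> g"
  shows "(avg s ^^ i) f \<simeq> (avg s ^^ i) g"
proof (induction i)
  case (Suc i)
  show ?case
    using avg_cong_AE[OF assms(1) L2_borel L2_borel Suc.IH] avg_iter_L2[OF assms(1)] assms(2,3)
    by simp
qed (use assms in simp)

lemma avg_zero: "(\<And>x. x \<in> space \<pi> \<Longrightarrow> f x = 0) \<Longrightarrow> avg s f x = 0"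
  by (simp add: avg_def)

text \<open>Shaped for the eigenvalue equation, whose summands pair \<open>(P ^^ i) h\<close> with
  \<open>(A ^^ i) h\<close>: it applies a further operator termwise, and its conclusion has the form
  of its hypothesis, so it can be used repeatedly.\<close>

lemma avg_pair_sum_zero:
  assumes s: "admissible s" and L: "\<And>i. f i \<in> L2" "\<And>i. g i \<in> L2" and I: "finite I"
    and z: "AE x in \<pi>. (\<Sum>i\<in>I. f i x + g i x) = 0"
  shows "AE x in \<pi>. (\<Sum>i\<in>I. avg s (f i) x + avg s (g i) x) = 0"
proof -
  have "AE x in \<pi>. \<forall>i\<in>I. avg s (\<lambda>x. f i x + g i x) x = avg s (f i) x + avg s (g i) x"
    by (rule AE_finite_allI[OF I]) (rule avg_add_AE[OF s L])
  moreover have "avg s (\<lambda>x. \<Sum>i\<in>I. f i x + g i x) \<simeq> avg s (\<lambda>x. 0)"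
    by (rule avg_cong_AE[OF s _ _ z]) (auto intro!: L2_borel L2_sum L2_add L)
  moreover have "AE x in \<pi>. avg s (\<lambda>x. \<Sum>i\<in>I. f i x + g i x) x
      = (\<Sum>i\<in>I. avg s (\<lambda>x. f i x + g i x) x)"
    by (rule avg_sum_AE[OF s L2_add[OF L] I])
  ultimately show ?thesis
    by eventually_elim (simp add: avg_zero)
qed

section \<open>Functions of some of the coordinates\<close>

text \<open>Dependence is pointwise on \<open>space \<pi>\<close>, so identities drawn from it hold
  at every point. The bound on \<open>D\<close> keeps it among the positions that
  \<open>resample\<close> fills.\<close>

definition depends :: "nat set \<Rightarrow> ((nat \<Rightarrow> real) \<Rightarrow> real) \<Rightarrow> bool" where
  "depends D f \<longleftrightarrow> D \<subseteq> {1..k} \<and>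
     (\<forall>x\<in>space \<pi>. \<forall>y\<in>space \<pi>. (\<forall>i\<in>D. x i = y i) \<longrightarrow> f x = f y)"

lemma dependsD:
  "depends D f \<Longrightarrow> x \<in> space \<pi> \<Longrightarrow> y \<in> space \<pi> \<Longrightarrow> (\<And>i. i \<in> D \<Longrightarrow> x i = y i) \<Longrightarrow> f x = f y"
  unfolding depends_def by blast

lemma depends_all: "depends {1..k} f"
  unfolding depends_def space_pi
proof (intro conjI ballI impI order_refl)
  fix x y :: "nat \<Rightarrow> real"
  assume "x \<in> extensional {1..k}" "y \<in> extensional {1..k}" "\<forall>i\<in>{1..k}. x i = y i"
  then have "x = y" by (intro extensionalityI) auto
  then show "f x = f y" by simp
qed

text \<open>Position \<open>i\<close> of the resampled point reads variable \<open>s i\<close>, so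
  \<open>D\<close> is transported along \<open>s\<close>, and the position that receives \<xi> drops
  out by integration.\<close>

lemma depends_avg:
  assumes "depends D f" "D' \<subseteq> {1..k}" "\<And>i. i \<in> D \<Longrightarrow> s i \<noteq> 0 \<Longrightarrow> s i \<in> D'"
  shows "depends D' (avg s f)"
  unfolding depends_def
proof (intro conjI ballI impI assms(2))
  fix x y assume xy: "x \<in> space \<pi>" "y \<in> space \<pi>" "\<forall>i\<in>D'. x i = y i"
  have "f (resample s x \<xi>) = f (resample s y \<xi>)" for \<xi>
  proof (rule dependsD[OF assms(1)])
    fix i assume "i \<in> D"
    moreover from this have "i \<in> {1..k}" using assms(1) unfolding depends_def by blast
    ultimately show "resample s x \<xi> i = resample s y \<xi> i"
      using assms(3) xy(3) by (simp add: resample_def)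
  qed (fact resample_in_space)+
  then show "avg s f x = avg s f y" by (simp add: avg_def)
qed

lemma avg_depends:
  assumes "depends D f" "\<And>i. i \<in> D \<Longrightarrow> s i = i" "x \<in> space \<pi>"
  shows "avg s f x = f x"
proof -
  have "f (resample s x \<xi>) = f x" for \<xi>
  proof (rule dependsD[OF assms(1)])
    fix i assume "i \<in> D"
    moreover from this have "i \<in> {1..k}" using assms(1) unfolding depends_def by blast
    ultimately show "resample s x \<xi> i = x i"
      using assms(2) by (simp add: resample_def)
  qed (fact resample_in_space assms(3))+
  then show ?thesis using prob_space by (simp add: avg_def)
qed

section \<open>Scalar products, the two shifts and coordinate averages\<close>

text \<open>Over k + 1 iid variables, permutations of all indices including 0 become available. As
  \<open>g\<close> reads only the variables 1 to k, integrating out variable 0 affects only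
  \<open>f\<close>.\<close>

lemma integral_avg_mult:
  assumes s: "admissible s" and f: "f \<in> L2" and g: "g \<in> L2"
  shows "(\<integral>x. avg s f x * g x \<partial>\<pi>) =
    (\<integral>y. f (\<lambda>i\<in>{1..k}. y (s i)) * g (\<lambda>i\<in>{1..k}. y i) \<partial>PiM {0..k} (\<lambda>_. \<nu>))"
proof -
  interpret Q: pair_sigma_finite \<pi> \<nu> by (rule pair_pi_nu)
  \<comment> \<open>The identity counts as a resampling that ignores \<xi>, so \<open>G\<close> can
    be treated exactly like \<open>F\<close>.\<close>
  have id: "admissible (\<lambda>i. i)" by (auto simp: admissible_def)
  have res_id: "resample (\<lambda>i. i) x \<xi> = x" if "x \<in> space \<pi>" for x \<xi>
    using that by (auto simp: space_pi resample_def intro!: extensionalityI)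
  have sI: "s ` {1..k} \<subseteq> {0..k}" using s by (simp add: admissible_def)
  define F where "F = (\<lambda>(x, \<xi>). f (resample s x \<xi>))"
  define G where "G = (\<lambda>(x, \<xi>). g (resample (\<lambda>i. i) x \<xi>))"
  have meas: "F \<in> borel_measurable (\<pi> \<Otimes>\<^sub>M \<nu>)" "G \<in> borel_measurable (\<pi> \<Otimes>\<^sub>M \<nu>)"
    unfolding F_def G_def
    by (intro measurable_compose_resample s id L2_borel f g)+
  have "integrable (\<pi> \<Otimes>\<^sub>M \<nu>) (\<lambda>p. (F p)\<^sup>2)" "integrable (\<pi> \<Otimes>\<^sub>M \<nu>) (\<lambda>p. (G p)\<^sup>2)"
    using integrable_resample[OF s, of "\<lambda>x. (f x)\<^sup>2"] f
      integrable_resample[OF id, of "\<lambda>x. (g x)\<^sup>2"] g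
    by (auto simp: L2_def F_def G_def case_prod_unfold)
  from integrable_mult_of_squares[OF meas this]
  have int: "integrable (\<pi> \<Otimes>\<^sub>M \<nu>) (\<lambda>p. F p * G p)" .
  have "(\<integral>y. f (\<lambda>i\<in>{1..k}. y (s i)) * g (\<lambda>i\<in>{1..k}. y i) \<partial>PiM {0..k} (\<lambda>_. \<nu>)) =
    (\<integral>y. f (\<lambda>i\<in>{1..k}. y (s i)) * g (\<lambda>i\<in>{1..k}. y i)
      \<partial>distr (\<pi> \<Otimes>\<^sub>M \<nu>) (PiM {0..k} (\<lambda>_. \<nu>)) (\<lambda>(x, \<xi>). x(0 := \<xi>)))"
    unfolding distr_extend ..
  also have "\<dots> = (\<integral>p. F p * G p \<partial>(\<pi> \<Otimes>\<^sub>M \<nu>))"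
  proof (subst integral_distr[OF measurable_extend])
    have "(\<lambda>i. i) ` {1..k} \<subseteq> {0..k}" by auto
    from measurable_compose[OF measurable_reindex[OF sI] L2_borel[OF f]]
      measurable_compose[OF measurable_reindex[OF this] L2_borel[OF g]]
    show "(\<lambda>y. f (\<lambda>i\<in>{1..k}. y (s i)) * g (\<lambda>i\<in>{1..k}. y i))
        \<in> borel_measurable (PiM {0..k} (\<lambda>_. \<nu>))"
      by (rule borel_measurable_times)
  qed (simp only: F_def G_def resample_eq_reindex case_prod_unfold)
  also have "\<dots> = (\<integral>x. \<integral>\<xi>. F (x, \<xi>) * G (x, \<xi>) \<partial>\<nu> \<partial>\<pi>)"
    using Q.integral_fst'[OF int] by simp
  also have "\<dots> = (\<integral>x. avg s f x * g x \<partial>\<pi>)"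
    by (rule Bochner_Integration.integral_cong) (simp_all add: F_def G_def res_id avg_def)
  finally show ?thesis ..
qed

definition shift_left :: "nat \<Rightarrow> nat" where
  "shift_left i = (if i < k then i + 1 else 0)"

text \<open>The value at 1 is 0, so the first position receives the fresh variable.\<close>

definition shift_right :: "nat \<Rightarrow> nat" where
  "shift_right i = i - 1"

definition omit :: "nat \<Rightarrow> nat \<Rightarrow> nat" where
  "omit j i = (if i = j then 0 else i)"

abbreviation "P \<equiv> avg shift_left"
abbreviation "A \<equiv> avg shift_right"
abbreviation "E j \<equiv> avg (omit j)"

lemma admissible_shift [simp]:
  "admissible shift_left" "admissible shift_right" "admissible (omit j)"
  by (auto simp: admissible_def shift_left_def shift_right_def omit_def inj_on_def split: if_splits)

lemma P_op_eq: "P_op k \<nu> = P"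
proof (intro ext)
  fix f x
  have "(\<lambda>i\<in>{1..k}. if i < k then x (i + 1) else \<xi>) = resample shift_left x \<xi>" for \<xi>
    by (auto simp: resample_def shift_left_def restrict_def)
  then show "P_op k \<nu> f x = P f x" by (simp add: P_op_def avg_def)
qed

text \<open>Over k + 1 iid variables \<open>f\<close> is read at (y_2, ..., y_k, y_0) and
  \<open>g\<close> at (y_1, ..., y_k). The cyclic rotation \<open>\<tau>\<close> of the indices
  turns these arguments into (y_1, ..., y_k) and (y_0, ..., y_(k-1)), and the latter are those that
  \<open>A\<close> gives to \<open>g\<close>.\<close>

lemma P_adjoint:
  assumes f: "f \<in> L2" and g: "g \<in> L2"
  shows "(\<integral>x. P f x * g x \<partial>\<pi>) = (\<integral>x. f x * A g x \<partial>\<pi>)"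
proof -
  let ?Y = "PiM {0..k} (\<lambda>_. \<nu>)"
  define \<tau> where "\<tau> i = (if i = 0 then k else i - 1)" for i
  have \<tau>: "inj_on \<tau> {0..k}" "\<tau> ` {0..k} \<subseteq> {0..k}"
    by (auto simp: \<tau>_def inj_on_def split: if_splits)
  let ?T = "\<lambda>y. \<lambda>i\<in>{0..k}. y (\<tau> i)"
  let ?H = "\<lambda>y. f (\<lambda>i\<in>{1..k}. y (shift_left i)) * g (\<lambda>i\<in>{1..k}. y i)"
  have H: "?H \<in> borel_measurable ?Y"
  proof -
    have "shift_left ` {1..k} \<subseteq> {0..k}" "(\<lambda>i. i) ` {1..k} \<subseteq> {0..k}"
      by (auto simp: shift_left_def)
    note m = this[THEN measurable_reindex]
    show ?thesis
      by (rule borel_measurable_times)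
        (rule measurable_compose[OF m(1) L2_borel[OF f]] measurable_compose[OF m(2) L2_borel[OF g]])+
  qed
  have "(\<integral>x. P f x * g x \<partial>\<pi>) = (\<integral>y. ?H y \<partial>?Y)"
    by (rule integral_avg_mult) (use f g in auto)
  also have "\<dots> = (\<integral>y. ?H y \<partial>distr ?Y ?Y ?T)"
    unfolding distr_reindex[OF \<tau>] ..
  also have "\<dots> = (\<integral>y. ?H (?T y) \<partial>?Y)"
    by (rule integral_distr[OF measurable_reindex[OF \<tau>(2)] H])
  also have "\<dots> = (\<integral>y. g (\<lambda>i\<in>{1..k}. y (shift_right i)) * f (\<lambda>i\<in>{1..k}. y i) \<partial>?Y)"
  proof (rule Bochner_Integration.integral_cong[OF refl])
    fix y :: "nat \<Rightarrow> real"
    have "(\<lambda>i\<in>{1..k}. ?T y (shift_left i)) = (\<lambda>i\<in>{1..k}. y i)"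
      "(\<lambda>i\<in>{1..k}. ?T y i) = (\<lambda>i\<in>{1..k}. y (shift_right i))"
      by (auto simp: shift_left_def shift_right_def \<tau>_def restrict_def fun_eq_iff
          le_antisym not_less)
    then show "?H (?T y) = g (\<lambda>i\<in>{1..k}. y (shift_right i)) * f (\<lambda>i\<in>{1..k}. y i)"
      by (simp only: mult.commute)
  qed
  also have "\<dots> = (\<integral>x. A g x * f x \<partial>\<pi>)"
    by (rule integral_avg_mult[symmetric]) (use f g in auto)
  finally show ?thesis by (simp add: mult.commute)
qed

lemma P_iter_adjoint:
  assumes "f \<in> L2" "g \<in> L2"
  shows "(\<integral>x. (P ^^ i) f x * g x \<partial>\<pi>) = (\<integral>x. f x * (A ^^ i) g x \<partial>\<pi>)"
  using assms
proof (induction i arbitrary: g)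
  case (Suc i)
  have "(\<integral>x. (P ^^ Suc i) f x * g x \<partial>\<pi>) = (\<integral>x. (P ^^ i) f x * A g x \<partial>\<pi>)"
    using P_adjoint[OF avg_iter_L2[OF _ Suc.prems(1)] Suc.prems(2), of shift_left] by simp
  also have "\<dots> = (\<integral>x. f x * (A ^^ i) (A g) x \<partial>\<pi>)"
    by (rule Suc.IH) (use Suc.prems avg_L2 in auto)
  finally show ?case by (simp add: funpow_swap1)
qed simp

text \<open>For j < k, position j of the shifted point holds \<open>x (j + 1)\<close>, so averaging
  out j before the shift is averaging out j + 1 after it. The two sides are one double integral
  taken in both orders.\<close>

lemma P_E_commute:
  assumes f: "f \<in> L2" and j: "1 \<le> j" "j < k"
  shows "P (E j f) \<simeq> E (j + 1) (P f)"
proof -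
  interpret N: pair_sigma_finite \<nu> \<nu>
    unfolding pair_sigma_finite_def by (intro conjI prob_space_imp_sigma_finite prob_space_axioms)
  have int: "integrable \<pi> f" and int': "integrable \<pi> (\<lambda>x. \<bar>f x\<bar>)"
    using L2_integrable[OF f] by auto
  note sh = admissible_shift(1) and om = admissible_shift(3)[of j]
  have swap: "resample (omit j) (resample shift_left x \<xi>) \<eta> =
      resample shift_left (resample (omit (j + 1)) x \<eta>) \<xi>" for x \<xi> \<eta>
    using j by (auto simp: resample_def omit_def shift_left_def restrict_def fun_eq_iff)
  \<comment> \<open>With the absolute value of \<open>f\<close> this is the finiteness condition
    that justifies Fubini for almost every \<open>x\<close>.\<close>
  have "AE x in \<pi>. integrable \<nu> (\<lambda>\<xi>. E j (\<lambda>x. \<bar>f x\<bar>) (resample shift_left x \<xi>))"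
    by (rule integrable_avg(1)[OF sh integrable_avg(2)[OF om int']])
  moreover have "AE x in \<pi>. AE \<xi> in \<nu>.
      integrable \<nu> (\<lambda>\<eta>. f (resample (omit j) (resample shift_left x \<xi>) \<eta>))"
    by (rule AE_resample[OF sh integrable_avg(1)[OF om int]])
  ultimately show ?thesis using AE_space
  proof eventually_elim
    case (elim x)
    let ?g = "\<lambda>\<xi> \<eta>. f (resample (omit j) (resample shift_left x \<xi>) \<eta>)"
    have "(\<lambda>p. (resample shift_left x (fst p), snd p)) \<in> measurable (\<nu> \<Otimes>\<^sub>M \<nu>) (\<pi> \<Otimes>\<^sub>M \<nu>)"
      by (intro measurable_Pair measurable_snd
          measurable_compose[OF measurable_fst measurable_resample[OF sh elim(3)]])
    from measurable_compose[OF this measurable_compose_resample[OF om L2_borel[OF f]]]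
    have "(\<lambda>p. ?g (fst p) (snd p)) \<in> borel_measurable (\<nu> \<Otimes>\<^sub>M \<nu>)" by simp
    then have "integrable (\<nu> \<Otimes>\<^sub>M \<nu>) (\<lambda>p. ?g (fst p) (snd p))"
      by (rule N.Fubini_integrable) (use elim in \<open>simp_all add: avg_def\<close>)
    then have "integrable (\<nu> \<Otimes>\<^sub>M \<nu>) (case_prod ?g)" by (simp add: case_prod_unfold)
    from N.Fubini_integral[OF this] show ?case unfolding avg_def by (simp only: swap)
  qed
qed

lemma P_iter_E:
  assumes f: "f \<in> L2" and "i < k"
  shows "(P ^^ i) (E 1 f) \<simeq> E (i + 1) ((P ^^ i) f)"
  using assms(2)
proof (induction i)
  case (Suc i)
  have L: "(P ^^ i) (E 1 f) \<in> L2" "(P ^^ i) f \<in> L2"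
    using f by (simp_all add: avg_iter_L2 avg_L2)
  have "P ((P ^^ i) (E 1 f)) \<simeq> P (E (i + 1) ((P ^^ i) f))"
    by (rule avg_cong_AE) (use Suc L in \<open>simp_all add: L2_borel avg_L2\<close>)
  moreover have "P (E (i + 1) ((P ^^ i) f)) \<simeq> E (Suc (i + 1)) (P ((P ^^ i) f))"
    using P_E_commute[OF L(2), of "i + 1"] Suc.prems unfolding Suc_eq_plus1 by simp
  ultimately show ?case by eventually_elim simp
qed simp

text \<open>Of the two fresh variables, the one drawn by \<open>P\<close> is shifted out again by
  \<open>A\<close>; integrating it contributes a factor 1, so the identity holds at every
  point.\<close>

lemma P_A: "P (A f) = E 1 f"
proof
  fix x
  have "resample shift_right (resample shift_left x \<xi>) \<eta> = resample (omit 1) x \<eta>" for \<xi> \<eta>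
    by (auto simp: resample_def omit_def shift_left_def shift_right_def restrict_def fun_eq_iff)
  then show "P (A f) x = E 1 f x" using prob_space by (simp add: avg_def)
qed

lemma A_P: "A (P f) = E k f"
proof
  fix x
  have "resample shift_left (resample shift_right x \<eta>) \<xi> = resample (omit k) x \<xi>" for \<xi> \<eta>
    by (auto simp: resample_def omit_def shift_left_def shift_right_def restrict_def fun_eq_iff)
  then show "A (P f) x = E k f x" using prob_space by (simp add: avg_def)
qed

section \<open>Mean-zero functions and nilpotency of the shifts\<close>

lemma hilb_iff: "f \<in> hilb k \<nu> \<longleftrightarrow> f \<in> L2 \<and> (\<integral>x. f x \<partial>\<pi>) = 0"
  by (auto simp: hilb_def L2_def)

lemma avg_hilb: "admissible s \<Longrightarrow> f \<in> hilb k \<nu> \<Longrightarrow> avg s f \<in> hilb k \<nu>"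
  by (simp add: hilb_iff avg_L2 integrable_avg(3) L2_integrable)

lemma avg_iter_hilb: "admissible s \<Longrightarrow> f \<in> hilb k \<nu> \<Longrightarrow> (avg s ^^ i) f \<in> hilb k \<nu>"
  by (induction i) (auto intro: avg_hilb)

lemma depends_P_iter: "depends {i + 1..k} ((P ^^ i) f)"
proof (induction i)
  case (Suc i)
  have "depends {Suc i + 1..k} (P ((P ^^ i) f))"
    by (rule depends_avg[OF Suc.IH]) (auto simp: shift_left_def split: if_splits)
  then show ?case by simp
qed (use depends_all in simp)

lemma depends_A_iter: "depends {1..k - i} ((A ^^ i) f)"
proof (induction i)
  case (Suc i)
  have "depends {1..k - Suc i} (A ((A ^^ i) f))"
    by (rule depends_avg[OF Suc.IH]) (auto simp: shift_right_def)
  then show ?case by simp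
qed (use depends_all in simp)

text \<open>A function of no coordinates equals its own mean. After k shifts no coordinate is left,
  so both k-th iterates vanish at every point of \<open>space \<pi>\<close>.\<close>

lemma hilb_constant_zero:
  assumes f: "f \<in> hilb k \<nu>" and d: "depends {} f" and x: "x \<in> space \<pi>"
  shows "f x = 0"
proof -
  interpret Pi: prob_space \<pi> by (rule prob_pi)
  have "(\<integral>y. f y \<partial>\<pi>) = (\<integral>y. f x \<partial>\<pi>)"
    by (rule Bochner_Integration.integral_cong[OF refl]) (erule dependsD[OF d _ x], simp)
  also have "\<dots> = f x" using Pi.prob_space by simp
  finally show ?thesis using f by (simp add: hilb_iff)
qed

lemma P_iter_k_zero: "f \<in> hilb k \<nu> \<Longrightarrow> x \<in> space \<pi> \<Longrightarrow> (P ^^ k) f x = 0"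
  using depends_P_iter[of k f] by (intro hilb_constant_zero avg_iter_hilb) auto

lemma A_iter_k_zero: "f \<in> hilb k \<nu> \<Longrightarrow> x \<in> space \<pi> \<Longrightarrow> (A ^^ k) f x = 0"
  using depends_A_iter[of k f] by (intro hilb_constant_zero avg_iter_hilb) auto

lemma P_A_fixed: "depends {2..k} g \<Longrightarrow> x \<in> space \<pi> \<Longrightarrow> P (A g) x = g x"
  unfolding P_A by (erule avg_depends) (auto simp: omit_def)

lemma A_P_fixed: "depends {1..k - 1} g \<Longrightarrow> x \<in> space \<pi> \<Longrightarrow> A (P g) x = g x"
  unfolding A_P by (erule avg_depends) (use k_ge_2 in \<open>auto simp: omit_def\<close>)

text \<open>One application of \<open>P\<close> already removes x_1, and \<open>P (A _)\<close> only
  averages out x_1; at \<open>i = 0\<close> the identity fails in general.\<close>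

lemma P_A_P_iter:
  assumes "1 \<le> i" "x \<in> space \<pi>"
  shows "P (A ((P ^^ i) f)) x = (P ^^ i) f x"
proof -
  obtain m where m: "i = Suc m" using assms(1) by (cases i) auto
  have "depends {2..k} (P ((P ^^ m) f))"
    by (rule depends_avg[OF depends_all]) (auto simp: shift_left_def split: if_splits)
  then show ?thesis using P_A_fixed assms(2) m by simp
qed

section \<open>The chosen adjoint and the eigenvalue equation\<close>

text \<open>\<open>A f\<close> meets the specification of the choice, so the chosen element meets it
  too. Testing their difference \<open>?d\<close> against itself shows that it has norm 0.\<close>

lemma hadjoint_P:
  assumes f: "f \<in> hilb k \<nu>"
  shows "hadjoint k \<nu> P f \<in> hilb k \<nu>" "hadjoint k \<nu> P f \<simeq> A f"
proof -
  let ?Q = "\<lambda>g. g \<in> hilb k \<nu> \<and> (\<forall>h\<in>hilb k \<nu>. hinner k \<nu> (P h) f = hinner k \<nu> h g)"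
  let ?g = "hadjoint k \<nu> P f"
  have A: "?Q (A f)"
    using avg_hilb[OF admissible_shift(2) f] f by (auto simp: hinner_def P_adjoint hilb_iff)
  then have g: "?Q ?g"
    unfolding hadjoint_def by (rule someI[of ?Q])
  then show "?g \<in> hilb k \<nu>" by blast
  have gL: "?g \<in> L2" and AL: "A f \<in> L2" using g A by (auto simp: hilb_iff)
  let ?d = "\<lambda>x. ?g x - A f x"
  have dL: "?d \<in> L2" by (rule L2_diff[OF gL AL])
  have d: "?d \<in> hilb k \<nu>"
    using dL g A gL AL by (simp add: hilb_iff L2_integrable)
  have "(\<integral>x. ?d x * ?d x \<partial>\<pi>) = (\<integral>x. ?d x * ?g x - ?d x * A f x \<partial>\<pi>)"
    by (simp add: right_diff_distrib)
  also have "\<dots> = hinner k \<nu> ?d ?g - hinner k \<nu> ?d (A f)"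
    unfolding hinner_def
    by (rule Bochner_Integration.integral_diff) (intro L2_mult dL gL AL)+
  also have "\<dots> = 0" using g A d by auto
  finally have "AE x in \<pi>. ?d x * ?d x = 0"
    by (subst (asm) integral_nonneg_eq_0_iff_AE) (auto intro: L2_mult dL)
  then show "?g \<simeq> A f" by eventually_elim simp
qed

text \<open>Membership in \<open>hilb\<close> is carried along because the next chosen element is
  identified only for arguments in \<open>hilb\<close>.\<close>

lemma hadjoint_P_iter:
  assumes f: "f \<in> hilb k \<nu>"
  shows "(hadjoint k \<nu> P ^^ i) f \<in> hilb k \<nu> \<and> (hadjoint k \<nu> P ^^ i) f \<simeq> (A ^^ i) f"
proof (induction i)
  case (Suc i)
  let ?g = "(hadjoint k \<nu> P ^^ i) f"
  have "hadjoint k \<nu> P ?g \<simeq> A ?g" using Suc hadjoint_P by blast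
  moreover have "A ?g \<simeq> A ((A ^^ i) f)"
    by (rule avg_cong_AE) (use Suc f avg_iter_L2[of shift_right f i] in \<open>auto simp: hilb_iff intro: L2_borel\<close>)
  ultimately have "hadjoint k \<nu> P ?g \<simeq> A ((A ^^ i) f)" by (rule aeq_trans)
  then show ?case using Suc hadjoint_P(1) by simp
qed (use f in simp)

lemma B_op_AE:
  assumes f: "f \<in> hilb k \<nu>"
  shows "AE x in \<pi>. B_op k \<nu> f x = f x + (\<Sum>i = 1..k - 1. (P ^^ i) f x + (A ^^ i) f x)"
proof -
  have "AE x in \<pi>. \<forall>i\<in>{1..k - 1}. (hadjoint k \<nu> P ^^ i) f x = (A ^^ i) f x"
    by (rule AE_finite_allI) (use hadjoint_P_iter[OF f] in auto)
  then show ?thesis by eventually_elim (simp add: B_op_def P_op_eq)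
qed

lemma B_eigenspace_1_iff:
  assumes "f \<in> hilb k \<nu>"
  shows "f \<in> B_eigenspace k \<nu> 1 \<longleftrightarrow>
    (AE x in \<pi>. (\<Sum>i = 1..k - 1. (P ^^ i) f x + (A ^^ i) f x) = 0)"
proof -
  have "(AE x in \<pi>. B_op k \<nu> f x = 1 * f x) \<longleftrightarrow>
    (AE x in \<pi>. (\<Sum>i = 1..k - 1. (P ^^ i) f x + (A ^^ i) f x) = 0)"
    by (rule eventually_subst) (use B_op_AE[OF assms] in \<open>eventually_elim, simp\<close>)
  with assms show ?thesis by (simp add: B_eigenspace_def)
qed

section \<open>The eigenspace as the common kernel of \<open>P\<close> and \<open>A\<close>\<close>

lemma P_eq_P_A:
  assumes h: "h \<in> hilb k \<nu>"
    and z: "AE x in \<pi>. (\<Sum>i = 1..k - 1. (P ^^ i) h x + (A ^^ i) h x) = 0"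
  shows "P h \<simeq> P (A h)"
proof -
  have hL: "h \<in> L2" using h by (simp add: hilb_iff)
  note L = avg_iter_L2[OF _ hL]
  let ?I = "{1..k - 1}"
  have 1: "AE x in \<pi>. (\<Sum>i\<in>?I. (P ^^ Suc i) h x + P ((A ^^ i) h) x) = 0"
    using avg_pair_sum_zero[OF _ _ _ _ z, of shift_left] L by simp
  have "AE x in \<pi>. (\<Sum>i\<in>?I. A ((P ^^ i) h) x + (A ^^ Suc i) h x) = 0"
    using avg_pair_sum_zero[OF _ _ _ _ z, of shift_right] L by simp
  then have 2: "AE x in \<pi>. (\<Sum>i\<in>?I. P (A ((P ^^ i) h)) x + P ((A ^^ Suc i) h) x) = 0"
    by (intro avg_pair_sum_zero) (use L in \<open>auto intro!: avg_L2\<close>)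
  from 1 2 AE_space show ?thesis
  proof eventually_elim
    case (elim x)
    \<comment> \<open>The first sum has terms \<open>u (Suc i) + v i\<close>, the second
      \<open>u i + v (Suc i)\<close>. Their difference telescopes between 1 and k, and both values
      at k are 0.\<close>
    define u where "u i = (P ^^ i) h x" for i
    define v where "v i = P ((A ^^ i) h) x" for i
    have uk: "u k = 0" unfolding u_def by (rule P_iter_k_zero[OF h elim(3)])
    have vk: "v k = 0" unfolding v_def by (rule avg_zero) (rule A_iter_k_zero[OF h])
    have I: "?I = {1..<k}" using k_ge_2 by auto
    have "(\<Sum>i\<in>?I. P (A ((P ^^ i) h)) x) = (\<Sum>i\<in>?I. u i)"
      unfolding u_def by (rule sum.cong[OF refl]) (use P_A_P_iter elim(3) in auto)
    with elim(1,2) have "(\<Sum>i\<in>{1..<k}. u (Suc i) - u i) = (\<Sum>i\<in>{1..<k}. v (Suc i) - v i)"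
      unfolding I sum.distrib sum_subtractf u_def v_def by linarith
    then have "u k - u 1 = v k - v 1"
      using k_ge_2 by (simp add: sum_Suc_diff')
    then show ?case using uk vk by (simp add: u_def v_def One_nat_def)
  qed
qed

text \<open>The hypothesis concerns \<open>h\<close> alone and cannot be reused for
  \<open>(A ^^ i) h\<close>. Instead \<open>P (A _)\<close> is moved out as
  \<open>E (i + 1)\<close>, the induction hypothesis is applied beneath it, and it is moved back
  in.\<close>

lemma P_iter_eq:
  assumes h: "h \<in> L2" and eq: "P h \<simeq> P (A h)" and i: "i < k"
  shows "(P ^^ i) h \<simeq> (P ^^ i) ((A ^^ i) h)"
  using i
proof (induction i)
  case (Suc i)
  note L = avg_L2 avg_iter_L2 L2_borel h
  have "(P ^^ i) (P h) \<simeq> (P ^^ i) (E 1 h)"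
    using avg_iter_cong[OF _ _ _ eq] L by (simp add: P_A)
  moreover have "(P ^^ i) (E 1 h) \<simeq> E (i + 1) ((P ^^ i) h)"
    by (rule P_iter_E) (use h Suc in auto)
  moreover have "E (i + 1) ((P ^^ i) h) \<simeq> E (i + 1) ((P ^^ i) ((A ^^ i) h))"
    by (rule avg_cong_AE) (use L Suc in auto)
  moreover have "(P ^^ i) (E 1 ((A ^^ i) h)) \<simeq> E (i + 1) ((P ^^ i) ((A ^^ i) h))"
    by (rule P_iter_E) (use L Suc in auto)
  ultimately have "(P ^^ i) (P h) \<simeq> (P ^^ i) (P (A ((A ^^ i) h)))"
    unfolding P_A by eventually_elim simp
  then show ?case by (simp add: funpow_swap1)
qed simp

lemma eigenspace_kernel:
  assumes h: "h \<in> hilb k \<nu>"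
    and z: "AE x in \<pi>. (\<Sum>i = 1..k - 1. (P ^^ i) h x + (A ^^ i) h x) = 0"
  shows "A h \<simeq> (\<lambda>x. 0)" "P h \<simeq> (\<lambda>x. 0)"
proof -
  have hL: "h \<in> L2" using h by (simp add: hilb_iff)
  note L = avg_iter_L2[OF _ hL]
  note PA = P_eq_P_A[OF h z]
  let ?n = "\<lambda>i. \<integral>x. (A ^^ i) h x * (A ^^ i) h x \<partial>\<pi>"
  have P_h: "(\<integral>x. (P ^^ i) h x * h x \<partial>\<pi>) = ?n i" if "i < k" for i
  proof -
    have "(\<integral>x. (P ^^ i) h x * h x \<partial>\<pi>) = (\<integral>x. (P ^^ i) ((A ^^ i) h) x * h x \<partial>\<pi>)"
    proof (rule integral_cong_AE)
      show "AE x in \<pi>. (P ^^ i) h x * h x = (P ^^ i) ((A ^^ i) h) x * h x"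
        using P_iter_eq[OF hL PA that] by eventually_elim simp
    qed (use L in \<open>auto intro!: borel_measurable_integrable L2_mult avg_iter_L2 hL\<close>)
    also have "\<dots> = ?n i" by (rule P_iter_adjoint) (use L hL in auto)
    finally show ?thesis .
  qed
  \<comment> \<open>By adjointness and symmetry of the real scalar product this equals the
    \<open>P\<close> term, whence the factor 2 below.\<close>
  have A_h: "(\<integral>x. (A ^^ i) h x * h x \<partial>\<pi>) = ?n i" if "i < k" for i
    using P_iter_adjoint[OF hL hL, of i] P_h[OF that] by (simp add: mult.commute)
  have "0 = (\<integral>x. (\<Sum>i = 1..k - 1. (P ^^ i) h x + (A ^^ i) h x) * h x \<partial>\<pi>)"
  proof (rule integral_eq_zero_AE[symmetric])
    show "AE x in \<pi>. (\<Sum>i = 1..k - 1. (P ^^ i) h x + (A ^^ i) h x) * h x = 0"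
      using z by eventually_elim simp
  qed
  also have "\<dots> = (\<integral>x. (\<Sum>i = 1..k - 1. (P ^^ i) h x * h x + (A ^^ i) h x * h x) \<partial>\<pi>)"
    by (simp add: sum_distrib_right distrib_right)
  also have "\<dots> = (\<Sum>i = 1..k - 1. \<integral>x. (P ^^ i) h x * h x + (A ^^ i) h x * h x \<partial>\<pi>)"
    by (rule Bochner_Integration.integral_sum)
      (intro Bochner_Integration.integrable_add L2_mult L hL admissible_shift)
  also have "\<dots> = (\<Sum>i = 1..k - 1. 2 * ?n i)"
  proof (rule sum.cong[OF refl])
    fix i assume "i \<in> {1..k - 1}"
    then have i: "i < k" using k_ge_2 by auto
    have "(\<integral>x. (P ^^ i) h x * h x + (A ^^ i) h x * h x \<partial>\<pi>) =
        (\<integral>x. (P ^^ i) h x * h x \<partial>\<pi>) + (\<integral>x. (A ^^ i) h x * h x \<partial>\<pi>)"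
      by (rule Bochner_Integration.integral_add) (intro L2_mult L hL admissible_shift)+
    then show "(\<integral>x. (P ^^ i) h x * h x + (A ^^ i) h x * h x \<partial>\<pi>) = 2 * ?n i"
      by (simp only: P_h[OF i] A_h[OF i] mult_2)
  qed
  finally have "(\<Sum>i = 1..k - 1. 2 * ?n i) = 0" by (rule sym)
  then have "\<forall>i\<in>{1..k - 1}. 2 * ?n i = 0"
    by (subst (asm) sum_nonneg_eq_0_iff) (auto intro!: integral_nonneg_AE)
  \<comment> \<open>The index 1 lies in the range because k is at least 2.\<close>
  then have "2 * ?n 1 = 0" using k_ge_2 by (elim ballE) auto
  then have "(\<integral>x. A h x * A h x \<partial>\<pi>) = 0" by (simp add: One_nat_def)
  then have "AE x in \<pi>. A h x * A h x = 0"
    by (subst (asm) integral_nonneg_eq_0_iff_AE) (auto intro!: L2_mult avg_L2 hL)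
  then show A0: "A h \<simeq> (\<lambda>x. 0)" by eventually_elim simp
  have "P (A h) \<simeq> P (\<lambda>x. 0)"
    by (rule avg_cong_AE[OF _ _ _ A0]) (auto intro!: L2_borel avg_L2 hL)
  with PA show "P h \<simeq> (\<lambda>x. 0)"
    by eventually_elim (simp add: avg_zero)
qed

text \<open>With \<open>P f\<close> and \<open>A f\<close> zero on all of
  \<open>space \<pi>\<close>, every later iterate averages a function that is identically zero
  there.\<close>

lemma kernel_eigenspace:
  assumes f: "f \<in> hilb k \<nu>"
    and "\<And>x. x \<in> space \<pi> \<Longrightarrow> P f x = 0" "\<And>x. x \<in> space \<pi> \<Longrightarrow> A f x = 0"
  shows "f \<in> B_eigenspace k \<nu> 1"
proof -
  have "(P ^^ i) f x = 0 \<and> (A ^^ i) f x = 0" if "1 \<le> i" "x \<in> space \<pi>" for i x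
    using that
  proof (induction i arbitrary: x rule: dec_induct)
    case base
    then show ?case using assms by (simp add: One_nat_def)
  next
    case (step n)
    then show ?case by (simp add: avg_zero)
  qed
  then have "AE x in \<pi>. (\<Sum>i = 1..k - 1. (P ^^ i) f x + (A ^^ i) f x) = 0"
    by (intro AE_I2 sum.neutral) simp
  with B_eigenspace_1_iff[OF f] show ?thesis by blast
qed

lemma eigenspace_orthogonal:
  assumes h: "h \<in> B_eigenspace k \<nu> 1" and g: "g \<in> L2"
    and d: "depends {2..k} g \<or> depends {1..k - 1} g"
  shows "hinner k \<nu> g h = 0"
proof -
  have hH: "h \<in> hilb k \<nu>" using h by (simp add: B_eigenspace_def)
  then have hL: "h \<in> L2" by (simp add: hilb_iff)
  note k0 = eigenspace_kernel[OF hH B_eigenspace_1_iff[OF hH, THEN iffD1, OF h]]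
  from d show ?thesis
  proof
    assume "depends {2..k} g"
    then have "hinner k \<nu> g h = (\<integral>x. P (A g) x * h x \<partial>\<pi>)"
      unfolding hinner_def
      by (intro Bochner_Integration.integral_cong[OF refl]) (simp only: P_A_fixed)
    also have "\<dots> = (\<integral>x. A g x * A h x \<partial>\<pi>)"
      by (rule P_adjoint) (simp_all add: avg_L2 g hL)
    also have "\<dots> = 0"
      by (rule integral_eq_zero_AE) (use k0(1) in \<open>eventually_elim, simp\<close>)
    finally show ?thesis .
  next
    assume "depends {1..k - 1} g"
    then have "hinner k \<nu> g h = (\<integral>x. h x * A (P g) x \<partial>\<pi>)"
      unfolding hinner_def
      by (intro Bochner_Integration.integral_cong[OF refl]) (simp only: A_P_fixed mult.commute)
    also have "\<dots> = (\<integral>x. P h x * P g x \<partial>\<pi>)"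
      by (rule P_adjoint[symmetric]) (simp_all add: avg_L2 g hL)
    also have "\<dots> = 0"
      by (rule integral_eq_zero_AE) (use k0(2) in \<open>eventually_elim, simp\<close>)
    finally show ?thesis .
  qed
qed

section \<open>Signs and the distribution function\<close>

lemma coordinate_measurable: "i \<in> {1..k} \<Longrightarrow> (\<lambda>x. x i) \<in> borel_measurable \<pi>"
  using measurable_component_singleton[of i "{1..k}" "\<lambda>_. \<nu>"]
  by (simp add: measurable_cong_sets[OF refl events_eq_borel])

lemma sgn_L2:
  assumes "a \<in> {1..k}" "b \<in> {1..k}"
  shows "(\<lambda>x. sgn (x a - x b)) \<in> L2"
proof (rule L2_bounded[where c=1])
  have "sgn \<in> borel_measurable (borel :: real measure)" by measurable
  from measurable_compose[OF borel_measurable_diff[OF assms[THEN coordinate_measurable]] this]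
  show "(\<lambda>x. sgn (x a - x b)) \<in> borel_measurable \<pi>" .
qed (simp add: sgn_if)

lemma cdf_measurable: "cdf \<nu> \<in> borel_measurable borel"
  by (rule borel_measurable_mono) (auto intro!: monoI finite_borel_measure.cdf_nondecreasing[OF finite_borel_measure_M])

lemma cdf_bounded: "\<bar>cdf \<nu> x\<bar> \<le> 1"
  by (simp add: cdf_def)

lemma cdf_L2: "a \<in> {1..k} \<Longrightarrow> (\<lambda>x. cdf \<nu> (x a)) \<in> L2"
  by (rule L2_bounded[OF _ cdf_bounded])
    (rule measurable_compose[OF coordinate_measurable cdf_measurable])

text \<open>Exchanging coordinates \<open>a\<close> and \<open>b\<close> preserves
  \<open>\<pi>\<close> and flips the sign of the integrand. This yields mean zero both for the terms
  of K and for K1.\<close>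

lemma integral_antisymmetric:
  fixes \<psi> :: "real \<Rightarrow> real \<Rightarrow> real"
  assumes ab: "a \<in> {1..k}" "b \<in> {1..k}" and m: "(\<lambda>x. \<psi> (x a) (x b)) \<in> borel_measurable \<pi>"
    and anti: "\<And>y z. \<psi> y z = - \<psi> z y"
  shows "(\<integral>x. \<psi> (x a) (x b) \<partial>\<pi>) = 0"
proof -
  define \<sigma> where "\<sigma> i = (if i = a then b else if i = b then a else i)" for i
  have \<sigma>: "inj_on \<sigma> {1..k}" "\<sigma> ` {1..k} \<subseteq> {1..k}"
    using ab by (auto simp: \<sigma>_def inj_on_def)
  let ?T = "\<lambda>y. \<lambda>i\<in>{1..k}. y (\<sigma> i)"
  have "(\<integral>x. \<psi> (x a) (x b) \<partial>\<pi>) = (\<integral>x. \<psi> (x a) (x b) \<partial>distr \<pi> \<pi> ?T)"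
    unfolding distr_reindex[OF \<sigma>] ..
  also have "\<dots> = (\<integral>x. \<psi> (?T x a) (?T x b) \<partial>\<pi>)"
    by (rule integral_distr[OF measurable_reindex[OF \<sigma>(2)] m])
  also have "\<dots> = (\<integral>x. \<psi> (x b) (x a) \<partial>\<pi>)"
    using ab by (simp add: \<sigma>_def)
  also have "\<dots> = - (\<integral>x. \<psi> (x a) (x b) \<partial>\<pi>)"
    by (subst anti) simp
  finally show ?thesis by simp
qed

text \<open>Absolute continuity enters here: the sign and \<open>1 - 2 * indicator {..c}\<close>
  differ only at \<open>c\<close>, which is then a null set.\<close>

lemma integral_sgn:
  assumes "absolutely_continuous lborel \<nu>"
  shows "(\<integral>\<xi>. sgn (\<xi> - c) \<partial>\<nu>) = 1 - 2 * cdf \<nu> c"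
proof -
  have "{c} \<in> null_sets lborel" by (rule finite_imp_null_set_lborel) simp
  then have "{c} \<in> null_sets \<nu>" using assms by (auto simp: absolutely_continuous_def)
  then have "AE \<xi> in \<nu>. \<xi> \<notin> {c}" by (rule AE_not_in)
  then have "AE \<xi> in \<nu>. sgn (\<xi> - c) = 1 - 2 * indicator {..c} \<xi>"
    by eventually_elim (auto simp: indicator_def sgn_if)
  then have "(\<integral>\<xi>. sgn (\<xi> - c) \<partial>\<nu>) = (\<integral>\<xi>. 1 - 2 * indicator {..c} \<xi> \<partial>\<nu>)"
    by (intro integral_cong_AE) auto
  also have "\<dots> = (\<integral>\<xi>. 1 \<partial>\<nu>) - (\<integral>\<xi>. 2 * indicator {..c} \<xi> \<partial>\<nu>)"
    by (rule Bochner_Integration.integral_diff)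
      (auto intro!: integrable_real_mult_indicator simp: less_top[symmetric])
  also have "\<dots> = 1 - 2 * cdf \<nu> c"
    using prob_space by (simp add: cdf_def)
  finally show ?thesis .
qed

lemma integral_sgn':
  assumes "absolutely_continuous lborel \<nu>"
  shows "(\<integral>\<xi>. sgn (c - \<xi>) \<partial>\<nu>) = 2 * cdf \<nu> c - 1"
proof -
  have "(\<integral>\<xi>. sgn (c - \<xi>) \<partial>\<nu>) = (\<integral>\<xi>. - sgn (\<xi> - c) \<partial>\<nu>)"
    by (rule arg_cong[where f="integral\<^sup>L \<nu>"]) (auto simp: sgn_if)
  then show ?thesis using integral_sgn[OF assms] by simp
qed

lemma cdf_integrable: "integrable \<nu> (cdf \<nu>)"
  by (rule integrable_const_bound[where B=1])
    (use cdf_bounded cdf_measurable in \<open>auto simp: measurable_cong_sets[OF events_eq_borel refl]\<close>)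

lemma sgn_integrable: "integrable \<nu> (\<lambda>\<xi>. sgn (\<xi> - c))" "integrable \<nu> (\<lambda>\<xi>. sgn (c - \<xi>))"
  by (rule integrable_const_bound[where B=1]; simp add: sgn_if)+

text \<open>Integrating sgn(x - y) in both orders gives 1 - 2m = 2m - 1 for the mean m of the
  distribution function.\<close>

lemma integral_cdf:
  assumes ac: "absolutely_continuous lborel \<nu>"
  shows "(\<integral>\<xi>. cdf \<nu> \<xi> \<partial>\<nu>) = 1 / 2"
proof -
  interpret N: pair_sigma_finite \<nu> \<nu>
    unfolding pair_sigma_finite_def by (intro conjI prob_space_imp_sigma_finite prob_space_axioms)
  interpret NN: prob_space "\<nu> \<Otimes>\<^sub>M \<nu>" by (rule prob_space_pair) unfold_locales
  have "integrable (\<nu> \<Otimes>\<^sub>M \<nu>) (\<lambda>(x, y). sgn (x - y))"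
  proof (rule NN.integrable_const_bound[where B=1])
    have "(\<lambda>p. sgn (fst p - snd p)) \<in> borel_measurable (\<nu> \<Otimes>\<^sub>M \<nu>)" by measurable
    then show "(\<lambda>(x, y). sgn (x - y)) \<in> borel_measurable (\<nu> \<Otimes>\<^sub>M \<nu>)"
      by (simp add: case_prod_unfold)
  qed (auto simp: sgn_if)
  from N.Fubini_integral[OF this]
  have "(\<integral>y. 1 - 2 * cdf \<nu> y \<partial>\<nu>) = (\<integral>x. 2 * cdf \<nu> x - 1 \<partial>\<nu>)"
    by (simp only: integral_sgn[OF ac] integral_sgn'[OF ac])
  then show ?thesis
    using prob_space by (simp add: cdf_integrable)
qed

section \<open>The kernel K and its projection\<close>

lemma orthogonal_sum:
  assumes "\<And>i. i \<in> I \<Longrightarrow> f i \<in> L2" "h \<in> L2" "\<And>i. i \<in> I \<Longrightarrow> hinner k \<nu> (f i) h = 0"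
  shows "hinner k \<nu> (\<lambda>x. \<Sum>i\<in>I. f i x) h = 0"
proof -
  have "hinner k \<nu> (\<lambda>x. \<Sum>i\<in>I. f i x) h = (\<Sum>i\<in>I. hinner k \<nu> (f i) h)"
    unfolding hinner_def sum_distrib_right
    by (rule Bochner_Integration.integral_sum) (intro L2_mult assms)
  then show ?thesis using assms(3) by simp
qed

lemma hilb_sum:
  assumes "\<And>i. i \<in> I \<Longrightarrow> f i \<in> hilb k \<nu>"
  shows "(\<lambda>x. \<Sum>i\<in>I. f i x) \<in> hilb k \<nu>"
proof -
  have "(\<integral>x. (\<Sum>i\<in>I. f i x) \<partial>\<pi>) = (\<Sum>i\<in>I. \<integral>x. f i x \<partial>\<pi>)"
    by (rule Bochner_Integration.integral_sum) (use assms in \<open>auto simp: hilb_iff L2_integrable\<close>)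
  with assms show ?thesis by (auto simp: hilb_iff intro!: L2_sum)
qed

lemma K_hilb: "(\<lambda>x. \<Sum>\<Delta> = 1..k - 1. \<Sum>j = 1..k - \<Delta>. \<alpha> \<Delta> * sgn (x (\<Delta> + j) - x j)) \<in> hilb k \<nu>"
proof (intro hilb_sum)
  fix \<Delta> j assume "\<Delta> \<in> {1..k - 1}" "j \<in> {1..k - \<Delta>}"
  then have idx: "\<Delta> + j \<in> {1..k}" "j \<in> {1..k}" by auto
  have L: "(\<lambda>x. \<alpha> \<Delta> * sgn (x (\<Delta> + j) - x j)) \<in> L2"
    by (intro L2_cmult sgn_L2 idx)
  have "(\<integral>x. \<alpha> \<Delta> * sgn (x (\<Delta> + j) - x j) \<partial>\<pi>) = 0"
    by (rule integral_antisymmetric[where \<psi>="\<lambda>y z. \<alpha> \<Delta> * sgn (y - z)"])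
      (use idx L2_borel[OF L] in \<open>auto simp: sgn_if\<close>)
  with L show "(\<lambda>x. \<alpha> \<Delta> * sgn (x (\<Delta> + j) - x j)) \<in> hilb k \<nu>" by (simp add: hilb_iff)
qed

lemma K1_eigenspace:
  assumes ac: "absolutely_continuous lborel \<nu>"
  shows "(\<lambda>x. c * (sgn (x k - x 1) - 2 * (cdf \<nu> (x k) - cdf \<nu> (x 1)))) \<in> B_eigenspace k \<nu> 1"
    (is "?K1 \<in> _")
proof (rule kernel_eigenspace)
  have idx: "k \<in> {1..k}" "1 \<in> {1..k}" using k_ge_2 by auto
  have L: "?K1 \<in> L2"
    by (intro L2_cmult L2_diff sgn_L2 cdf_L2 idx)
  have "(\<integral>x. ?K1 x \<partial>\<pi>) = 0"
    by (rule integral_antisymmetric[where \<psi>="\<lambda>y z. c * (sgn (y - z) - 2 * (cdf \<nu> y - cdf \<nu> z))"])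
      (use idx L2_borel[OF L] in \<open>auto simp: sgn_if algebra_simps\<close>)
  with L show "?K1 \<in> hilb k \<nu>" by (simp add: hilb_iff)
  fix x
  \<comment> \<open>The left shift puts \<open>x 2\<close> in the first position and \<xi> in the
    last; these positions are distinct as k is at least 2. The right shift below likewise leaves
    \<xi> and \<open>x (k - 1)\<close>.\<close>
  have "P ?K1 x = (\<integral>\<xi>. c * (sgn (\<xi> - x 2) - 2 * (cdf \<nu> \<xi> - cdf \<nu> (x 2))) \<partial>\<nu>)"
    using k_ge_2 by (simp add: avg_def resample_def shift_left_def)
  also have "\<dots> = c * ((\<integral>\<xi>. sgn (\<xi> - x 2) \<partial>\<nu>) - 2 * ((\<integral>\<xi>. cdf \<nu> \<xi> \<partial>\<nu>) - cdf \<nu> (x 2)))"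
    using prob_space by (simp add: sgn_integrable cdf_integrable)
  also have "\<dots> = 0" by (simp add: integral_sgn[OF ac] integral_cdf[OF ac])
  finally show "P ?K1 x = 0" .
  have "A ?K1 x = (\<integral>\<xi>. c * (sgn (x (k - 1) - \<xi>) - 2 * (cdf \<nu> (x (k - 1)) - cdf \<nu> \<xi>)) \<partial>\<nu>)"
    using k_ge_2 by (simp add: avg_def resample_def shift_right_def)
  also have "\<dots> = c * ((\<integral>\<xi>. sgn (x (k - 1) - \<xi>) \<partial>\<nu>) - 2 * (cdf \<nu> (x (k - 1)) - (\<integral>\<xi>. cdf \<nu> \<xi> \<partial>\<nu>)))"
    using prob_space by (simp add: sgn_integrable cdf_integrable)
  also have "\<dots> = 0" by (simp add: integral_sgn'[OF ac] integral_cdf[OF ac])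
  finally show "A ?K1 x = 0" .
qed

text \<open>Subtracting K1 cancels the one sign that involves both x_1 and x_k and leaves two
  functions of a single coordinate in its place.\<close>

lemma K_minus_K1_orthogonal:
  assumes h: "h \<in> B_eigenspace k \<nu> 1"
  shows "hinner k \<nu> (\<lambda>x. (\<Sum>\<Delta> = 1..k - 1. \<Sum>j = 1..k - \<Delta>. \<alpha> \<Delta> * sgn (x (\<Delta> + j) - x j)) -
    \<alpha> (k - 1) * (sgn (x k - x 1) - 2 * (cdf \<nu> (x k) - cdf \<nu> (x 1)))) h = 0"
proof -
  have hL: "h \<in> L2" using h by (simp add: B_eigenspace_def hilb_iff)
  have idx: "k \<in> {1..k}" "1 \<in> {1..k}" using k_ge_2 by auto
  define a where "a = 2 * \<alpha> (k - 1)"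
  \<comment> \<open>\<open>T\<close> lists the summands of K - K1. At
    \<open>\<Delta> = k - 1\<close> the inner sum has the single index 1, so the replacement need
    not mention \<open>j\<close>.\<close>
  define T where "T \<Delta> j x =
    (if \<Delta> = k - 1 then a * cdf \<nu> (x k) - a * cdf \<nu> (x 1) else \<alpha> \<Delta> * sgn (x (\<Delta> + j) - x j))"
    for \<Delta> j and x :: "nat \<Rightarrow> real"
  have T: "T \<Delta> j \<in> L2 \<and> hinner k \<nu> (T \<Delta> j) h = 0"
    if \<Delta>j: "\<Delta> \<in> {1..k - 1}" "j \<in> {1..k - \<Delta>}" for \<Delta> j
  proof (cases "\<Delta> = k - 1")
    case True
    let ?f = "\<lambda>x. a * cdf \<nu> (x k)" and ?g = "\<lambda>x. a * cdf \<nu> (x 1)"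
    have L: "?f \<in> L2" "?g \<in> L2" by (intro L2_cmult cdf_L2 idx)+
    have "hinner k \<nu> ?f h = 0" "hinner k \<nu> ?g h = 0"
      by (rule eigenspace_orthogonal[OF h L(1)], use k_ge_2 in \<open>simp add: depends_def\<close>)
        (rule eigenspace_orthogonal[OF h L(2)], use k_ge_2 in \<open>simp add: depends_def\<close>)
    moreover have "hinner k \<nu> (\<lambda>x. ?f x - ?g x) h = hinner k \<nu> ?f h - hinner k \<nu> ?g h"
      unfolding hinner_def left_diff_distrib
      by (rule Bochner_Integration.integral_diff) (intro L2_mult L hL)+
    moreover have "T \<Delta> j = (\<lambda>x. ?f x - ?g x)" using True by (simp add: T_def fun_eq_iff)
    ultimately show ?thesis using L2_diff[OF L] by simp
  next
    case False
    have T_eq: "T \<Delta> j = (\<lambda>x. \<alpha> \<Delta> * sgn (x (\<Delta> + j) - x j))"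
      using False by (simp add: T_def fun_eq_iff)
    have L: "T \<Delta> j \<in> L2"
      unfolding T_eq by (intro L2_cmult sgn_L2) (use \<Delta>j in auto)
    \<comment> \<open>The indices \<open>j\<close> and \<open>\<Delta> + j\<close> are 1 and k
      together only if \<open>\<Delta> = k - 1\<close>, so one extreme coordinate is always
      missing.\<close>
    have "\<Delta> + j \<in> {2..k} \<and> j \<in> {2..k} \<or> \<Delta> + j \<in> {1..k - 1} \<and> j \<in> {1..k - 1}"
      using \<Delta>j False by auto
    then have "depends {2..k} (T \<Delta> j) \<or> depends {1..k - 1} (T \<Delta> j)"
      unfolding T_eq depends_def by auto
    from eigenspace_orthogonal[OF h L this] L show ?thesis by blast
  qed
  have "(\<lambda>x. (\<Sum>\<Delta> = 1..k - 1. \<Sum>j = 1..k - \<Delta>. \<alpha> \<Delta> * sgn (x (\<Delta> + j) - x j)) -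
      \<alpha> (k - 1) * (sgn (x k - x 1) - 2 * (cdf \<nu> (x k) - cdf \<nu> (x 1)))) =
    (\<lambda>x. \<Sum>\<Delta> = 1..k - 1. \<Sum>j = 1..k - \<Delta>. T \<Delta> j x)" (is "?L = ?R")
  proof
    fix x :: "nat \<Rightarrow> real"
    let ?c = "\<alpha> (k - 1) * (sgn (x k - x 1) - 2 * (cdf \<nu> (x k) - cdf \<nu> (x 1)))"
    \<comment> \<open>Comparing K with the sum of the \<open>T\<close> terms, only the summand with
      \<open>\<Delta> = k - 1\<close> and \<open>j = 1\<close> differs, and that difference is
      K1.\<close>
    have "(\<Sum>\<Delta> = 1..k - 1. \<Sum>j = 1..k - \<Delta>. \<alpha> \<Delta> * sgn (x (\<Delta> + j) - x j) - T \<Delta> j x) =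
        (\<Sum>\<Delta> = 1..k - 1. if \<Delta> = k - 1 then ?c else 0)"
    proof (rule sum.cong[OF refl])
      fix \<Delta>
      show "(\<Sum>j = 1..k - \<Delta>. \<alpha> \<Delta> * sgn (x (\<Delta> + j) - x j) - T \<Delta> j x) =
          (if \<Delta> = k - 1 then ?c else 0)"
      proof (cases "\<Delta> = k - 1")
        case True
        then have "{1..k - \<Delta>} = {1}" "\<Delta> + 1 = k" using k_ge_2 by auto
        with True show ?thesis by (simp add: T_def a_def algebra_simps)
      qed (simp add: T_def)
    qed
    also have "\<dots> = ?c" using k_ge_2 by simp
    finally show "?L x = ?R x" by (simp add: sum_subtractf)
  qed
  then show ?thesis
    using T hL by (simp only:) (intro orthogonal_sum L2_sum; blast)
qed

end

theorem mainTheorem8: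
  fixes k :: nat and \<alpha> :: "nat \<Rightarrow> real" and \<nu> :: "real measure" and F :: "real \<Rightarrow> real"
    and K K1 :: "(nat \<Rightarrow> real) \<Rightarrow> real"
  assumes "k \<ge> 2"
    and "real_distribution \<nu>"
    and "absolutely_continuous lborel \<nu>"
    and "F = cdf \<nu>"
    and "K = (\<lambda>x. \<Sum>\<Delta> = 1..k - 1. \<Sum>j = 1..k - \<Delta>. \<alpha> \<Delta> * sgn (x (\<Delta> + j) - x j))"
    and "K1 = (\<lambda>x. \<alpha> (k - 1) * (sgn (x k - x 1) - 2 * (F (x k) - F (x 1))))"
  shows "is_orth_proj k \<nu> (B_eigenspace k \<nu> 1) K K1"
proof -
  interpret iid_coordinates \<nu> k
    using assms(1,2) by (simp add: iid_coordinates_def iid_coordinates_axioms_def)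
  show ?thesis
    unfolding is_orth_proj_def assms(4-6)
    by (intro conjI ballI K_hilb K1_eigenspace[OF assms(3)] K_minus_K1_orthogonal)
qed

end
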